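(* Let $P=\{p_k;k\ge 1\}$ be a probability distribution on a countable alphabet $\mathscr{X}$, let $K=\sum_{k\ge 1}1[p_k>0]\in\{1,2,\dots\}\cup\{\infty\}$ be its effective cardinality, and let $t_n=\sum_{k\ge 1}np_k(1-p_k)^n$ for $n\ge 1$. Then $K<\infty$ if and only if $\lim_{n\to\infty}t_n=0$.
   Context: $\mathscr{X}=\{\ell_k;k\ge 1\}$ is an alphabet with countably many letters. A probability distribution on $\mathscr{X}$ is a sequence $P=\{p_k;k\ge 1\}$ with $p_k\ge 0$ and $\sum_{k\ge1} p_k=1$, where $p_k$ is the probability of the letter $\ell_k$. The quantity $t_n$ is called the tail index. $1[\cdot]$ denotes an indicator. *)

theory Defs
  imports "HOL-Analysis.Analysis"
begin

(* Sequences are indexed by k >= 1; the value at k = 0 is never used. *)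

definition prob_distribution :: "(nat \<Rightarrow> real) \<Rightarrow> bool" where
  "prob_distribution p \<longleftrightarrow> (\<forall>k\<ge>1. p k \<ge> 0) \<and> (p has_sum 1) {1..}"

definition effective_cardinality :: "(nat \<Rightarrow> real) \<Rightarrow> enat" where
  "effective_cardinality p = (\<Sum>\<^sub>\<infinity>k\<in>{1..}. of_bool (p k > 0))"

(* The sum converges for every prob_distribution p, as the summand is at most n * p k. *)
definition tail_index :: "(nat \<Rightarrow> real) \<Rightarrow> nat \<Rightarrow> real" where
  "tail_index p n = (\<Sum>\<^sub>\<infinity>k\<in>{1..}. real n * p k * (1 - p k) ^ n)"

end

(* If the support is infinite, it contains letters k of arbitrarily small probability.  For such k take
   n = floor (1 / (2 p k)): then n p k lies in [1/4, 1/2], so that by Bernoulli's inequality the k-th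
   summand of t_n alone is at least 1/8, and these n are unbounded. *)

theory Submission
  imports Defs
begin

lemma prob_distribution_sum_le_1:
  assumes "prob_distribution p" "finite F" "F \<subseteq> {1..}"
  shows "sum p F \<le> 1"
proof (rule has_sum_mono_neutral)
  show "(p has_sum sum p F) F"
    using assms(2) by (rule has_sum_finite)
  show "(p has_sum 1) {1..}"
    using assms(1) by (simp add: prob_distribution_def)
qed (use assms in \<open>auto simp: prob_distribution_def\<close>)

lemma prob_distribution_le_1:
  assumes "prob_distribution p" "k \<ge> 1"
  shows "p k \<le> 1"
  using prob_distribution_sum_le_1[of p "{k}"] assms by simp

text \<open>Letters of probability at least \<open>e\<close> each take that much of the total mass
  1, so there are at most 1 / \<open>e\<close> of them. Hence an infinite support must contain
  arbitrarily small positive probabilities.\<close>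

lemma finite_prob_ge:
  assumes "prob_distribution p" "e > 0"
  shows "finite {k. k \<ge> 1 \<and> p k \<ge> e}"
proof (rule ccontr)
  assume "infinite {k. k \<ge> 1 \<and> p k \<ge> e}"
  then obtain F where F: "finite F" "card F = Suc (nat \<lceil>1 / e\<rceil>)" "F \<subseteq> {k. k \<ge> 1 \<and> p k \<ge> e}"
    using infinite_arbitrarily_large by blast
  have "1 / e < real (card F)"
    unfolding F(2) by linarith
  then have "1 < real (card F) * e"
    using assms(2) by (simp add: field_simps)
  also have "\<dots> \<le> sum p F"
    using sum_bounded_below[of F e p] F(3) by auto
  also have "\<dots> \<le> 1"
    using F by (intro prob_distribution_sum_le_1[OF assms(1)]) auto
  finally show False by simp
qed

lemma effective_cardinality_finite_iff:
  "effective_cardinality p < \<infinity> \<longleftrightarrow> finite {k. k \<ge> 1 \<and> p k > 0}"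
proof
  let ?S = "{k. k \<ge> 1 \<and> p k > 0}"
  have eq: "effective_cardinality p = (\<Sum>\<^sub>\<infinity>k\<in>?S. 1)"
    unfolding effective_cardinality_def by (rule infsum_cong_neutral) auto
  show "effective_cardinality p < \<infinity>" if "finite ?S"
    using that by (simp add: eq of_nat_eq_enat)
  show "finite ?S" if "effective_cardinality p < \<infinity>"
  proof (rule ccontr)
    assume "infinite ?S"
    \<comment> \<open>In \<open>enat\<close> a sum of infinitely many ones really is infinite; it
      does not fall back to the default value 0.\<close>
    then have "(\<Sum>\<^sub>\<infinity>k\<in>?S. 1 :: enat) = \<infinity>"
      by (intro infsum_superconst_infinite_enat[where b = 1]) auto
    then show False
      using that eq by simp
  qed
qed

lemma tail_index_ge_summand:
  assumes "prob_distribution p" "k \<ge> 1"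
  shows "real n * p k * (1 - p k) ^ n \<le> tail_index p n"
proof -
  let ?f = "\<lambda>k. real n * p k * (1 - p k) ^ n"
  have p: "0 \<le> p j" "p j \<le> 1" if "j \<ge> 1" for j
    using assms(1) prob_distribution_le_1 that by (auto simp: prob_distribution_def)
  \<comment> \<open>Summability has to be secured first, since \<open>infsum\<close> of a
    non-summable real family is 0. The factor \<open>(1 - p j) ^ n\<close> lies in [0, 1], so this
    family dominates.\<close>
  have "(\<lambda>j. real n * p j) summable_on {1..}"
    using assms(1) by (intro summable_on_cmult_right) (auto simp: prob_distribution_def summable_on_def)
  then have "?f summable_on {1..}"
    by (rule summable_on_comparison_test) (use p in \<open>auto intro!: mult_left_le power_le_one\<close>)
  then have "infsum ?f {k} \<le> infsum ?f {1..}"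
    using assms(2) p by (intro infsum_mono_neutral) auto
  then show ?thesis
    by (simp add: tail_index_def)
qed

text \<open>The bound 1 / 4 limits the loss from rounding \<open>n\<close> down, and the last bound
  forces \<open>n\<close> \<ge> \<open>N\<close>; writing \<open>N + 1\<close> keeps its denominator
  positive when \<open>N\<close> is 0.\<close>

lemma exists_summand_ge_eighth:
  fixes x :: real
  assumes "0 < x" "x \<le> 1 / 4" "x \<le> 1 / (2 * (real N + 1))"
  shows "\<exists>n\<ge>N. 1 / 8 \<le> real n * x * (1 - x) ^ n"
proof -
  define n where "n = nat \<lfloor>1 / (2 * x)\<rfloor>"
  have "real N + 1 \<le> 1 / (2 * x)"
    using assms by (simp add: field_simps)
  moreover have n: "real n \<le> 1 / (2 * x)" "1 / (2 * x) < real n + 1"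
    using assms(1) unfolding n_def by (simp, linarith)
  ultimately have "N \<le> n"
    by linarith
  have upper: "real n * x \<le> 1 / 2"
    using n(1) assms(1) by (simp add: field_simps)
  have "1 / 2 < real n * x + x"
    using n(2) assms(1) by (simp add: field_simps)
  \<comment> \<open>Rounding down costs less than \<open>x\<close>, hence less than 1 / 4 out of 1 /
    2.\<close>
  then have lower: "1 / 4 \<le> real n * x"
    using assms(2) by linarith
  have "1 + real n * (- x) \<le> (1 + (- x)) ^ n"
    using assms(2) by (intro Bernoulli_inequality) auto
  then have "1 / 2 \<le> (1 - x) ^ n"
    using upper by simp
  then have "1 / 4 * (1 / 2) \<le> real n * x * (1 - x) ^ n"
    using lower by (intro mult_mono) auto
  with \<open>N \<le> n\<close> show ?thesis
    by auto
qed

text \<open>Only letters of positive probability contribute, so the limit passes through a finite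
  sum whose terms are multiples of n q^n with 0 \<le> q < 1.\<close>

lemma tail_index_tendsto_0_if_finite:
  assumes "prob_distribution p" "finite {k. k \<ge> 1 \<and> p k > 0}"
  shows "tail_index p \<longlonglongrightarrow> 0"
proof -
  let ?S = "{k. k \<ge> 1 \<and> p k > 0}"
  have "tail_index p n = (\<Sum>\<^sub>\<infinity>k\<in>?S. real n * p k * (1 - p k) ^ n)" for n
    unfolding tail_index_def
    by (rule infsum_cong_neutral) (use assms(1) in \<open>auto simp: prob_distribution_def not_less intro: antisym\<close>)
  then have eq: "tail_index p = (\<lambda>n. \<Sum>k\<in>?S. p k * (real n * (1 - p k) ^ n))"
    using assms(2) by (simp add: fun_eq_iff mult_ac)
  have "(\<lambda>n. \<Sum>k\<in>?S. p k * (real n * (1 - p k) ^ n)) \<longlonglongrightarrow> (\<Sum>k\<in>?S. p k * 0)"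
  proof (intro tendsto_intros)
    fix k assume "k \<in> ?S"
    then have "norm (1 - p k) < 1"
      using prob_distribution_le_1[OF assms(1), of k] by auto
    then show "(\<lambda>n. real n * (1 - p k) ^ n) \<longlonglongrightarrow> 0"
      by (rule powser_times_n_limit_0)
  qed
  then show ?thesis
    by (simp add: eq)
qed

lemma finite_if_tail_index_tendsto_0:
  assumes "prob_distribution p" "tail_index p \<longlonglongrightarrow> 0"
  shows "finite {k. k \<ge> 1 \<and> p k > 0}"
proof (rule ccontr)
  assume inf: "infinite {k. k \<ge> 1 \<and> p k > 0}"
  have "eventually (\<lambda>n. tail_index p n < 1 / 8) sequentially"
    by (rule order_tendstoD(2)[OF assms(2)]) simp
  then obtain N where N: "tail_index p n < 1 / 8" if "n \<ge> N" for n
    by (auto simp: eventually_sequentially)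
  \<comment> \<open>The smaller of the two upper bounds required by
    \<open>exists_summand_ge_eighth\<close>.\<close>
  define e where "e = min (1 / 4) (1 / (2 * (real N + 1)))"
  have "e > 0"
    by (simp add: e_def)
  \<comment> \<open>Removing the finitely many letters of probability at least \<open>e\<close>
    leaves some letter of the support below \<open>e\<close>.\<close>
  with inf have "infinite ({k. k \<ge> 1 \<and> p k > 0} - {k. k \<ge> 1 \<and> p k \<ge> e})"
    using finite_prob_ge[OF assms(1)] by (intro Diff_infinite_finite) auto
  then obtain k where k: "k \<ge> 1" "p k > 0" "p k < e"
    by (force dest: infinite_imp_nonempty)
  then obtain n where "n \<ge> N" "1 / 8 \<le> real n * p k * (1 - p k) ^ n"
    using exists_summand_ge_eighth[of "p k" N] by (auto simp: e_def)
  with N[of n] tail_index_ge_summand[OF assms(1) k(1), of n] show False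
    by linarith
qed

theorem theorem1:
  fixes p :: "nat \<Rightarrow> real"
  assumes "prob_distribution p"
  shows "effective_cardinality p < \<infinity> \<longleftrightarrow> tail_index p \<longlonglongrightarrow> 0"
  using effective_cardinality_finite_iff tail_index_tendsto_0_if_finite
    finite_if_tail_index_tendsto_0 assms by blast

end
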